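(* There is an algorithm which, given a positive integer $S\geq 2$, computes all Benelux pairs $(m,n)$ and all Benelux pairs $(m,n)$ of second kind with $m<n<S$, with time complexity $\mathcal{O}(S\log S)$ and space complexity $\mathcal{O}(S)$.
   Context: For positive integers $m<n$: - $(m,n)$ is called a Benelux pair (of first kind) if $m$ and $n$ have the same set of prime factors, and $m+1$ and $n+1$ have the same set of prime factors (multiplicities are ignored). - $(m,n)$ is called a Benelux pair of second kind if $m$ and $n+1$ have the same set of prime factors, and $m+1$ and $n$ have the same set of prime factors (multiplicities are ignored). Complexity is measured in the unit-cost (word-RAM) model: each elementary arithmetic operation, comparison or memory access on integers of size polynomial in $S$ counts as one step, and each such integer occupies one unit of memory. Time complexity is the number of steps and space complexity is the number of memory units used, as functions of $S$. *)

theory Defs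
  imports Complex_Main "HOL-Computational_Algebra.Primes" "HOL-Library.Landau_Symbols"
begin

definition benelux_pair :: "nat \<Rightarrow> nat \<Rightarrow> bool" where
  "benelux_pair m n \<longleftrightarrow> 0 < m \<and> m < n \<and>
     prime_factors m = prime_factors n \<and> prime_factors (m + 1) = prime_factors (n + 1)"

definition benelux_pair2 :: "nat \<Rightarrow> nat \<Rightarrow> bool" where
  "benelux_pair2 m n \<longleftrightarrow> 0 < m \<and> m < n \<and>
     prime_factors m = prime_factors (n + 1) \<and> prime_factors (m + 1) = prime_factors n"

text \<open>
  A unit-cost random access machine. The memory maps addresses to natural numbers; there are no
  separate registers. In an instruction, i, j, k are fixed addresses, c is a fixed number and l is
  a position in the program. A program is a finite list of instructions that does not depend on
  the input, and it halts as soon as the program counter leaves the list.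
\<close>

type_synonym memory = "nat \<Rightarrow> nat"

type_synonym config = "nat \<times> memory"

datatype instr =
    Const nat nat
  | Move nat nat
  | Add nat nat nat
  | Sub nat nat nat
  | Mult nat nat nat
  | Div nat nat nat
  | Mod nat nat nat
  | Load nat nat
  | Store nat nat
  | Jump nat
  | JumpLess nat nat nat
  | JumpEq nat nat nat

type_synonym program = "instr list"

fun exec :: "instr \<Rightarrow> config \<Rightarrow> config" where
  "exec (Const i c) (pc, M) = (pc + 1, M(i := c))"
| "exec (Move i j) (pc, M) = (pc + 1, M(i := M j))"
| "exec (Add i j k) (pc, M) = (pc + 1, M(i := M j + M k))"
| "exec (Sub i j k) (pc, M) = (pc + 1, M(i := M j - M k))"
| "exec (Mult i j k) (pc, M) = (pc + 1, M(i := M j * M k))"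
| "exec (Div i j k) (pc, M) = (pc + 1, M(i := M j div M k))"
| "exec (Mod i j k) (pc, M) = (pc + 1, M(i := M j mod M k))"
| "exec (Load i j) (pc, M) = (pc + 1, M(i := M (M j)))"
| "exec (Store i j) (pc, M) = (pc + 1, M(M i := M j))"
| "exec (Jump l) (pc, M) = (l, M)"
| "exec (JumpLess i j l) (pc, M) = (if M i < M j then l else pc + 1, M)"
| "exec (JumpEq i j l) (pc, M) = (if M i = M j then l else pc + 1, M)"

fun accessed :: "instr \<Rightarrow> memory \<Rightarrow> nat set" where
  "accessed (Const i c) M = {i}"
| "accessed (Move i j) M = {i, j}"
| "accessed (Add i j k) M = {i, j, k}"
| "accessed (Sub i j k) M = {i, j, k}"
| "accessed (Mult i j k) M = {i, j, k}"
| "accessed (Div i j k) M = {i, j, k}"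
| "accessed (Mod i j k) M = {i, j, k}"
| "accessed (Load i j) M = {i, j, M j}"
| "accessed (Store i j) M = {i, j, M i}"
| "accessed (Jump l) M = {}"
| "accessed (JumpLess i j l) M = {i, j}"
| "accessed (JumpEq i j l) M = {i, j}"

definition halted :: "program \<Rightarrow> config \<Rightarrow> bool" where
  "halted P c \<longleftrightarrow> length P \<le> fst c"

definition step :: "program \<Rightarrow> config \<Rightarrow> config" where
  "step P c = (if halted P c then c else exec (P ! fst c) c)"

text \<open>The input is placed in cell 0 of a memory that is otherwise zero.\<close>

definition initial :: "nat \<Rightarrow> config" where
  "initial S = (0, (\<lambda>_. 0)(0 := S))"

definition config_at :: "program \<Rightarrow> nat \<Rightarrow> nat \<Rightarrow> config" where
  "config_at P S t = (step P ^^ t) (initial S)"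

definition halts_on :: "program \<Rightarrow> nat \<Rightarrow> bool" where
  "halts_on P S \<longleftrightarrow> (\<exists>t. halted P (config_at P S t))"

text \<open>The following quantities are only meaningful for an input on which the program halts.\<close>

definition running_time :: "program \<Rightarrow> nat \<Rightarrow> nat" where
  "running_time P S = (LEAST t. halted P (config_at P S t))"

definition final_memory :: "program \<Rightarrow> nat \<Rightarrow> memory" where
  "final_memory P S = snd (config_at P S (running_time P S))"

text \<open>
  The space is the length of the initial segment of the memory in which all accesses take place,
  so gaps between used cells are charged as well. It also covers the cells holding the output.
\<close>

definition space_used :: "program \<Rightarrow> nat \<Rightarrow> nat" where
  "space_used P S = (LEAST s. \<forall>t < running_time P S.
     \<forall>a \<in> accessed (P ! fst (config_at P S t)) (snd (config_at P S t)). a < s)"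

text \<open>
  The largest integer occurring in memory during the run. Unit cost is only legitimate if this
  is polynomially bounded, i.e. if logarithmically many bits per memory cell suffice.
\<close>

definition max_value :: "program \<Rightarrow> nat \<Rightarrow> nat" where
  "max_value P S = (LEAST b. \<forall>t \<le> running_time P S. \<forall>a. snd (config_at P S t) a \<le> b)"

text \<open>The list of k pairs stored consecutively from address a on.\<close>

definition pairs_at :: "memory \<Rightarrow> nat \<Rightarrow> nat \<Rightarrow> (nat \<times> nat) list" where
  "pairs_at M a k = map (\<lambda>i. (M (a + 2 * i), M (a + 2 * i + 1))) [0..<k]"

text \<open>
  On halting, cells 0 and 1 contain the address and the length of the first output list,
  cells 2 and 3 those of the second one.
\<close>

definition output1 :: "program \<Rightarrow> nat \<Rightarrow> (nat \<times> nat) list" where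
  "output1 P S = (let M = final_memory P S in pairs_at M (M 0) (M 1))"

definition output2 :: "program \<Rightarrow> nat \<Rightarrow> (nat \<times> nat) list" where
  "output2 P S = (let M = final_memory P S in pairs_at M (M 2) (M 3))"

definition computes_benelux_pairs :: "program \<Rightarrow> nat \<Rightarrow> bool" where
  "computes_benelux_pairs P S \<longleftrightarrow> halts_on P S \<and>
     distinct (output1 P S) \<and> set (output1 P S) = {(m, n). benelux_pair m n \<and> n < S} \<and>
     distinct (output2 P S) \<and> set (output2 P S) = {(m, n). benelux_pair2 m n \<and> n < S}"

end

(*
  Both kinds of pairs satisfy rad n * rad (n + 1) <= 2S and rad m * rad (m + 1) <= 2S: the coprime
  numbers rad n and rad (n + 1) both divide n - m, respectively m + n + 1. Call such numbers good.
  A good number n has rad n or rad (n + 1) below sqrt (2S), and Rankin's trick with exponent 1/4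
  shows that only O(S^(1/4)) numbers below S have a given radical, so there are O(S^(3/4)) good
  numbers, and comparing each good n with the good m of the same radical (respectively with
  rad m = rad (n + 1)) takes only O(S) steps. The same bound limits the size of the output. The
  radicals are computed by a sieve in O(S log S) steps.
*)

theory Submission imports Defs begin

section \<open>Bounded runs\<close>

text \<open>The exponent 1/4 balances two estimates. With Rankin exponent e, O(S^e) numbers up to S
  share a given radical. Radicals up to sqrt (2S) then account for O(S^(1/2 + e)) good numbers, and
  walking one list per good number costs O(S^(1/2 + 2e)), which is O(S) as long as e \<le> 1/4. The
  constant does not depend on the radical because a prime p contributes the factor 1 / (p^(1/4) -
  1), which is at most 1 from p = 16 on.

  An inspected pair need not be a Benelux pair, and the list of a single n may be long. Time and
  output space are therefore amortised: both are charged to the set \<open>visited\<close> of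
  inspected pairs, and the loop invariants carry the part of this budget that is still
  unspent.\<close>

definition bounded :: "nat \<Rightarrow> memory \<Rightarrow> bool" where
  "bounded v M \<longleftrightarrow> (\<forall>a. M a \<le> v)"

lemma bounded_upd [simp]: "bounded v M \<Longrightarrow> bounded v (M(a := x)) \<longleftrightarrow> x \<le> v"
  by (auto simp: bounded_def)

lemma boundedD: "bounded v M \<Longrightarrow> M a \<le> v"
  by (simp add: bounded_def)

text \<open>Time, addresses and cell contents are bounded by one predicate, so that a single
  induction per loop controls all three. Both rules check \<open>bounded\<close>, hence the last
  configuration is covered too.\<close>

inductive run :: "program \<Rightarrow> nat \<Rightarrow> nat \<Rightarrow> nat \<Rightarrow> config \<Rightarrow> config \<Rightarrow> bool"
  for P s v where
    run_refl: "bounded v (snd c) \<Longrightarrow> run P s v 0 c c"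
  | run_step: "fst c < length P \<Longrightarrow> \<forall>a \<in> accessed (P ! fst c) (snd c). a < s \<Longrightarrow>
      bounded v (snd c) \<Longrightarrow> run P s v t (exec (P ! fst c) c) c' \<Longrightarrow> run P s v (Suc t) c c'"

definition reaches ::
  "program \<Rightarrow> nat \<Rightarrow> nat \<Rightarrow> nat \<Rightarrow> config \<Rightarrow> (config \<Rightarrow> bool) \<Rightarrow> bool" where
  "reaches P s v T c Q \<longleftrightarrow> (\<exists>t \<le> T. \<exists>c'. run P s v t c c' \<and> Q c')"

text \<open>Symbolic execution by \<open>simp\<close>: \<open>k\<close> counts executed instructions
  rather than program positions, so a block may follow jumps.\<close>

fun block :: "program \<Rightarrow> nat \<Rightarrow> nat \<Rightarrow> nat \<Rightarrow> config \<Rightarrow> (config \<Rightarrow> bool) \<Rightarrow> bool" where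
  "block P s v 0 c Q \<longleftrightarrow> Q c"
| "block P s v (Suc k) (pc, M) Q \<longleftrightarrow> pc < length P \<and> (\<forall>a \<in> accessed (P ! pc) M. a < s) \<and>
     bounded v (snd (exec (P ! pc) (pc, M))) \<and> block P s v k (exec (P ! pc) (pc, M)) Q"

lemma block_numeral [simp]:
  "block P s v (numeral k) (pc, M) Q \<longleftrightarrow> pc < length P \<and> (\<forall>a \<in> accessed (P ! pc) M. a < s) \<and>
     bounded v (snd (exec (P ! pc) (pc, M))) \<and>
     block P s v (pred_numeral k) (exec (P ! pc) (pc, M)) Q"
  by (simp add: numeral_eq_Suc)

lemma run_bounded: "run P s v t c c' \<Longrightarrow> bounded v (snd c')"
  by (induction rule: run.induct) auto

lemma run_trans:
  "run P s v t c c' \<Longrightarrow> run P s v t' c' c'' \<Longrightarrow> run P s v (t + t') c c''"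
  by (induction rule: run.induct) (auto intro: run_step)

lemma reaches_refl: "bounded v (snd c) \<Longrightarrow> Q c \<Longrightarrow> reaches P s v T c Q"
  unfolding reaches_def by (blast intro: run_refl)

lemma reaches_mono: "reaches P s v T c Q \<Longrightarrow> T \<le> T' \<Longrightarrow> reaches P s v T' c Q"
  unfolding reaches_def by (meson le_trans)

lemma reaches_trans:
  assumes "reaches P s v T c Q"
    and "\<And>pc M. Q (pc, M) \<Longrightarrow> bounded v M \<Longrightarrow> reaches P s v T' (pc, M) R"
    and "T + T' \<le> T''"
  shows "reaches P s v T'' c R"
proof -
  from assms(1) obtain t c' where t: "t \<le> T" "run P s v t c c'" "Q c'"
    by (auto simp: reaches_def)
  with assms(2)[of "fst c'" "snd c'"] run_bounded[OF t(2)]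
  obtain t' c'' where t': "t' \<le> T'" "run P s v t' c' c''" "R c''"
    by (auto simp: reaches_def)
  have "t + t' \<le> T''" using t t' assms(3) by simp
  with run_trans[OF t(2) t'(2)] t'(3) show ?thesis
    unfolding reaches_def by blast
qed

text \<open>The block ends in another \<open>reaches\<close> goal, so after symbolic execution only
  an induction hypothesis or the next phase is left.\<close>

lemma reaches_block:
  assumes "block P s v k (pc, M) (\<lambda>c. reaches P s v T c Q)" and "bounded v M" and "k + T \<le> T'"
  shows "reaches P s v T' (pc, M) Q"
proof -
  have "reaches P s v (k + T) (pc, M) Q"
    using assms(1,2)
  proof (induction k arbitrary: pc M)
    case (Suc k)
    let ?c = "exec (P ! pc) (pc, M)"
    have "reaches P s v (k + T) ?c Q"
      using Suc.IH[of "fst ?c" "snd ?c"] Suc.prems by simp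
    then obtain t c' where "t \<le> k + T" "run P s v t ?c c'" "Q c'"
      by (auto simp: reaches_def)
    then have "run P s v (Suc t) (pc, M) c'" "Suc t \<le> Suc k + T" "Q c'"
      using Suc.prems by (auto intro: run_step)
    then show ?case
      unfolding reaches_def by blast
  qed simp
  then show ?thesis using assms(3) by (rule reaches_mono)
qed

lemma run_config:
  assumes "run P s v t c c'"
  shows "(step P ^^ t) c = c'"
    and "i < t \<Longrightarrow> \<not> halted P ((step P ^^ i) c)"
    and "i < t \<Longrightarrow> a \<in> accessed (P ! fst ((step P ^^ i) c)) (snd ((step P ^^ i) c)) \<Longrightarrow> a < s"
    and "i \<le> t \<Longrightarrow> snd ((step P ^^ i) c) a \<le> v"
proof -
  have "(step P ^^ t) c = c' \<and>
    (\<forall>i < t. \<not> halted P ((step P ^^ i) c) \<and>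
      (\<forall>a \<in> accessed (P ! fst ((step P ^^ i) c)) (snd ((step P ^^ i) c)). a < s)) \<and>
    (\<forall>i \<le> t. bounded v (snd ((step P ^^ i) c)))"
    using assms
  proof (induction rule: run.induct)
    case (run_step c t c')
    have s: "step P c = exec (P ! fst c) c"
      using run_step by (simp add: step_def halted_def)
    have eq: "(step P ^^ Suc i) c = (step P ^^ i) (exec (P ! fst c) c)" for i
      by (simp add: funpow_Suc_right s del: funpow.simps)
    have "\<not> halted P ((step P ^^ i) c) \<and>
      (\<forall>a \<in> accessed (P ! fst ((step P ^^ i) c)) (snd ((step P ^^ i) c)). a < s)"
      if "i < Suc t" for i
      using that run_step
      by (cases i) (simp_all add: eq halted_def del: funpow.simps(2))
    moreover have "bounded v (snd ((step P ^^ i) c))" if "i \<le> Suc t" for i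
      using that run_step by (cases i) (simp_all add: eq del: funpow.simps(2))
    ultimately show ?case using run_step by (simp add: eq del: funpow.simps)
  qed simp
  then show "(step P ^^ t) c = c'"
    and "i < t \<Longrightarrow> \<not> halted P ((step P ^^ i) c)"
    and "i < t \<Longrightarrow> a \<in> accessed (P ! fst ((step P ^^ i) c)) (snd ((step P ^^ i) c)) \<Longrightarrow> a < s"
    and "i \<le> t \<Longrightarrow> snd ((step P ^^ i) c) a \<le> v"
    by (auto simp: bounded_def)
qed

lemma reaches_halted:
  assumes "reaches P s v T (initial S) (\<lambda>(pc, M). length P \<le> pc \<and> Q M)"
  shows "halts_on P S" and "Q (final_memory P S)" and "running_time P S \<le> T"
    and "space_used P S \<le> s" and "max_value P S \<le> v"
proof -
  from assms obtain t c' where t: "t \<le> T" and run: "run P s v t (initial S) c'"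
    and c': "length P \<le> fst c'" "Q (snd c')"
    by (auto simp: reaches_def)
  have at: "config_at P S t = c'" and h: "halted P (config_at P S t)"
    using run_config(1)[OF run] c' by (auto simp: config_at_def halted_def)
  \<comment> \<open>No configuration before \<open>t\<close> is halted, so the \<open>LEAST\<close>
    in \<open>running_time\<close> is \<open>t\<close> itself; the other two minima only need upper
    bounds.\<close>
  have rt: "running_time P S = t"
    unfolding running_time_def
    by (rule Least_equality, rule h, rule ccontr)
       (use run_config(2)[OF run] in \<open>auto simp: config_at_def not_le\<close>)
  show "halts_on P S" using h by (auto simp: halts_on_def)
  show "Q (final_memory P S)" by (simp add: final_memory_def rt at c')
  show "running_time P S \<le> T" using rt t by simp
  show "space_used P S \<le> s" unfolding space_used_def
    by (rule Least_le) (use run_config(3)[OF run] in \<open>auto simp: config_at_def rt\<close>)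
  show "max_value P S \<le> v" unfolding max_value_def
    by (rule Least_le) (use run_config(4)[OF run] in \<open>auto simp: config_at_def rt\<close>)
qed

section \<open>Radicals and the number of inspected pairs\<close>

definition rad :: "nat \<Rightarrow> nat" where
  "rad n = \<Prod>(prime_factors n)"

lemma rad_pos: "0 < rad n"
  unfolding rad_def by (intro prod_pos ballI) (blast intro: prime_gt_0_nat in_prime_factors_imp_prime)

lemma prime_factors_rad: "prime_factors (rad n) = prime_factors n"
proof -
  have "rad n = prod_mset (mset_set (prime_factors n))"
    unfolding rad_def prod_unfold_prod_mset by simp
  then have "prime_factorization (rad n) = mset_set (prime_factors n)"
    by (subst \<open>rad n = _\<close>, intro prime_factorization_prod_mset_primes)
      (auto intro: in_prime_factors_imp_prime)
  then show ?thesis by simp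
qed

lemma rad_eq_iff: "rad m = rad n \<longleftrightarrow> prime_factors m = prime_factors n"
  by (metis prime_factors_rad rad_def)

lemma prod_primes_dvd:
  fixes n :: nat
  assumes "finite A" and "\<And>p. p \<in> A \<Longrightarrow> prime p \<and> p dvd n"
  shows "\<Prod>A dvd n"
  using assms
proof (induction A rule: finite_induct)
  case (insert p A)
  have "coprime p q" if "q \<in> A" for q
    using that insert by (intro primes_coprime) auto
  then have "coprime p (\<Prod>A)" by (rule prod_coprime_right)
  moreover have "\<Prod>A dvd n" "p dvd n" using insert by auto
  ultimately have "p * \<Prod>A dvd n" by (intro divides_mult)
  with insert.hyps show ?case by simp
qed simp

lemma rad_dvd: "rad n dvd n"
  unfolding rad_def by (rule prod_primes_dvd) auto

lemma rad_le: "0 < n \<Longrightarrow> rad n \<le> n"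
  by (simp add: dvd_imp_le rad_dvd)

lemma coprime_rad_Suc: "coprime (rad n) (rad (Suc n))"
  by (rule coprime_divisors[OF rad_dvd rad_dvd]) simp

definition good :: "nat \<Rightarrow> nat \<Rightarrow> bool" where
  "good S n \<longleftrightarrow> rad n * rad (Suc n) \<le> 2 * S"

text \<open>The bound is derived for \<open>n\<close> alone; it passes to \<open>m\<close> because
  equal radicals make \<open>rad m * rad (Suc m)\<close> the same product.\<close>

lemma benelux_pair_iff:
  assumes "n < S"
  shows "benelux_pair m n \<longleftrightarrow> 0 < m \<and> m < n \<and> good S m \<and> good S n \<and>
    rad m = rad n \<and> rad (Suc m) = rad (Suc n)"
proof -
  have "rad n * rad (Suc n) \<le> 2 * S"
    if "0 < m" "m < n" and eq: "rad m = rad n" "rad (Suc m) = rad (Suc n)"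
  proof -
    have "rad n dvd n - m"
      using rad_dvd[of m] rad_dvd[of n] eq by (simp add: dvd_diff_nat)
    moreover have "rad (Suc n) dvd Suc n - Suc m"
      using rad_dvd[of "Suc m"] rad_dvd[of "Suc n"] eq by (intro dvd_diff_nat) simp_all
    ultimately have "rad n * rad (Suc n) dvd n - m"
      using coprime_rad_Suc by (simp add: divides_mult)
    then have "rad n * rad (Suc n) \<le> n - m"
      using that by (intro dvd_imp_le) auto
    then show ?thesis using that assms by linarith
  qed
  then show ?thesis
    by (auto simp: benelux_pair_def good_def rad_eq_iff[symmetric])
qed

lemma benelux_pair2_iff:
  assumes "n < S"
  shows "benelux_pair2 m n \<longleftrightarrow> 0 < m \<and> m < n \<and> good S m \<and> good S n \<and>
    rad m = rad (Suc n) \<and> rad (Suc m) = rad n"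
proof -
  have "rad n * rad (Suc n) \<le> 2 * S"
    if "0 < m" "m < n" and eq: "rad m = rad (Suc n)" "rad (Suc m) = rad n"
  proof -
    have "rad n dvd Suc m + n" "rad (Suc n) dvd m + Suc n"
      using rad_dvd[of m] rad_dvd[of "Suc n"] rad_dvd[of "Suc m"] rad_dvd[of n] eq
      by (metis dvd_add)+
    then have "rad n * rad (Suc n) dvd Suc m + n"
      using coprime_rad_Suc by (simp add: divides_mult)
    then have "rad n * rad (Suc n) \<le> Suc m + n"
      using that by (intro dvd_imp_le) auto
    then show ?thesis using that assms by linarith
  qed
  then show ?thesis
    by (auto simp: benelux_pair2_def good_def rad_eq_iff[symmetric] mult.commute)
qed

section \<open>Rankin's bound for numbers with a prescribed radical\<close>

text \<open>A finite piece of an Euler product. Every prime of \<open>A\<close> occurs with exponent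
  j \<ge> 1, so its local factor is the geometric series of p^(-j/4) without the term j = 0, that is
  1 / (p^(1/4) - 1).\<close>

lemma sum_fourth_root_le:
  fixes F :: "nat set"
  assumes "finite A" and "\<forall>p \<in> A. prime p" and "finite F"
    and "\<forall>n \<in> F. 0 < n \<and> prime_factors n = A"
  shows "(\<Sum>n \<in> F. real n powr (-1/4)) \<le> (\<Prod>p \<in> A. 1 / (real p powr (1/4) - 1))"
  using assms
proof (induction A arbitrary: F rule: finite_induct)
  case empty
  have "n = 1" if "n \<in> F" for n
    using empty that by (auto simp: prime_factorization_empty_iff)
  then have "F \<subseteq> {1}" by auto
  then have "F = {} \<or> F = {1}" by auto
  then show ?case by auto
next
  case (insert p A)
  let ?w = "\<lambda>n::nat. real n powr (-1/4)"
  define q where "q = ?w p"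
  have p: "prime p" using insert by simp
  then have p1: "1 < real p" using prime_gt_1_nat by auto
  have q: "0 < q" "q < 1"
    unfolding q_def using p1 powr_less_mono[of "-1/4" 0 "real p"] by auto
  define k where "k = multiplicity p"
  define F' where "F' = (\<lambda>n. n div p ^ k n) ` F"
  \<comment> \<open>The inserted 1 keeps \<open>Max\<close> meaningful when \<open>F\<close> is
    empty.\<close>
  define K where "K = Max (insert 1 (k ` F))"
  have dec: "n = p ^ k n * (n div p ^ k n)" for n
    by (simp add: k_def multiplicity_dvd)
  have k: "k n \<in> {1..K}" if "n \<in> F" for n
  proof -
    have "p \<in> prime_factors n" using that insert.prems by auto
    then have "0 < k n" using p by (simp add: k_def prime_factors_multiplicity)
    moreover have "k n \<le> K" unfolding K_def using that insert.prems by (intro Max_ge) auto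
    ultimately show ?thesis by simp
  qed
  have F': "\<forall>m \<in> F'. 0 < m \<and> prime_factors m = A"
  proof (clarsimp simp only: F'_def ball_simps)
    fix n assume n: "n \<in> F"
    let ?m = "n div p ^ k n"
    have n0: "0 < n" "prime_factors n = insert p A" using n insert.prems by auto
    have m0: "0 < ?m" using dec[of n] n0 by (metis mult_0_right neq0_conv)
    have "prime_factors n = prime_factors (p ^ k n) \<union> prime_factors ?m"
      using dec[of n] m0 n0 p prime_factors_product[of "p ^ k n" ?m] by (simp add: prime_gt_0_nat)
    moreover have "prime_factors (p ^ k n) = {p}"
      unfolding prime_factorization_prime_power[OF p] using k[OF n] by simp
    moreover have "\<not> p dvd ?m"
      unfolding k_def by (rule multiplicity_decompose) (use n0 p in auto)
    then have "p \<notin> prime_factors ?m" by (rule contrapos_nn) (rule in_prime_factors_imp_dvd)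
    ultimately have "prime_factors ?m = A"
      using n0(2) insert.hyps(2) by (metis Diff_insert_absorb insert_is_Un)
    then show "0 < ?m \<and> prime_factors ?m = A" using m0 by simp
  qed
  have "(\<Sum>n \<in> F. ?w n) = (\<Sum>n \<in> F. q ^ k n * ?w (n div p ^ k n))"
  proof (rule sum.cong[OF refl])
    fix n assume "n \<in> F"
    have "?w n = ?w (p ^ k n * (n div p ^ k n))" using dec[of n] by simp
    also have "\<dots> = ?w (p ^ k n) * ?w (n div p ^ k n)" by (simp add: powr_mult)
    also have "?w (p ^ k n) = q ^ k n"
      using p1 by (simp add: q_def powr_power powr_powr flip: powr_realpow)
    finally show "?w n = q ^ k n * ?w (n div p ^ k n)" .
  qed
  \<comment> \<open>A number is recovered from its exponent at \<open>p\<close> and its cofactor, so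
    the reindexing is injective; enlarging the index set to a full rectangle then makes the sum
    factor.\<close>
  also have "\<dots> = (\<Sum>(j, m) \<in> (\<lambda>n. (k n, n div p ^ k n)) ` F. q ^ j * ?w m)"
    by (subst sum.reindex) (auto simp: inj_on_def, metis dec)
  also have "\<dots> \<le> (\<Sum>(j, m) \<in> {1..K} \<times> F'. q ^ j * ?w m)"
    using k q insert.prems by (intro sum_mono2) (auto simp: F'_def)
  also have "\<dots> = (\<Sum>j = 1..K. q ^ j) * (\<Sum>m \<in> F'. ?w m)"
    by (simp add: sum_product sum.cartesian_product)
  also have "\<dots> \<le> (q / (1 - q)) * (\<Prod>p \<in> A. 1 / (real p powr (1/4) - 1))"
  proof (rule mult_mono)
    have "(\<Sum>j = 1..K. q ^ j) = q * (\<Sum>j<K. q ^ j)"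
      by (simp add: sum_distrib_left sum.atLeast1_atMost_eq)
    also have "(\<Sum>j<K. q ^ j) \<le> 1 / (1 - q)"
      using q by (simp add: sum_gp_strict divide_right_mono)
    finally show "(\<Sum>j = 1..K. q ^ j) \<le> q / (1 - q)" using q by simp
    show "(\<Sum>m \<in> F'. ?w m) \<le> (\<Prod>p \<in> A. 1 / (real p powr (1/4) - 1))"
      using F' insert.prems by (intro insert.IH) (auto simp: F'_def)
  qed (use q in \<open>auto intro: sum_nonneg\<close>)
  also have "q / (1 - q) = 1 / (real p powr (1/4) - 1)"
    using q p1 by (simp add: q_def powr_minus field_simps)
  finally show ?case using insert.hyps by simp
qed

lemma card_rad_eq_bound:
  "\<exists>C > 0. \<forall>x r. real (card {n. 0 < n \<and> n \<le> x \<and> rad n = r}) \<le> C * real x powr (1/4)"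
proof (intro exI conjI allI)
  let ?g = "\<lambda>p. 1 / (real p powr (1/4) - 1)"
  \<comment> \<open>\<open>?g\<close> decreases and is at most 1 from 16 = 2^4 on. Only primes below
    16 can push the product above 1, each by at most \<open>?D\<close>; counting them crudely as 16
    gives \<open>?D ^ 16\<close>.\<close>
  let ?D = "max 1 (?g 2)"
  have fac: "?g p \<le> (if p < 16 then ?D else 1)" "0 \<le> ?g p" if "prime p" for p :: nat
  proof -
    have p: "2 \<le> p" using that prime_ge_2_nat by blast
    then have "real 2 powr (1/4) \<le> real p powr (1/4)" by (intro powr_mono2) auto
    moreover have "1 < real 2 powr (1/4)" by simp
    ultimately have "0 < real 2 powr (1/4) - 1"
      "real 2 powr (1/4) - 1 \<le> real p powr (1/4) - 1" by linarith+
    then have "?g p \<le> ?g 2" "0 \<le> ?g p"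
      using frac_le[of 1 1 "real 2 powr (1/4) - 1" "real p powr (1/4) - 1"]
        zero_le_divide_1_iff[of "real p powr (1/4) - 1"] by (simp, linarith)
    moreover have "?g p \<le> 1" if "16 \<le> p"
    proof -
      have "(16::real) powr (1/4) = (2 powr 4) powr (1/4)" by simp
      also have "\<dots> = 2" unfolding powr_powr by simp
      finally have "2 \<le> real p powr (1/4)"
        using powr_mono2[of "1/4" 16 "real p"] that by simp
      then show ?thesis by simp
    qed
    ultimately show "?g p \<le> (if p < 16 then ?D else 1)" "0 \<le> ?g p" by auto
  qed
  show "0 < ?D ^ 16" by (intro zero_less_power) simp
  fix x r
  let ?F = "{n. 0 < n \<and> n \<le> x \<and> rad n = r}"
  show "real (card ?F) \<le> ?D ^ 16 * real x powr (1/4)"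
  proof (cases "?F = {}")
    case False
    then obtain n0 where "0 < n0" "n0 \<le> x" and r: "r = rad n0" by auto
    define A where "A = prime_factors n0"
    have A: "finite A" "\<forall>p \<in> A. prime p" by (auto simp: A_def)
    have "real (card ?F) * real x powr (-1/4) = (\<Sum>n \<in> ?F. real x powr (-1/4))" by simp
    \<comment> \<open>Rankin's trick: a number n \<le> x has weight n^(-1/4) at least
      x^(-1/4).\<close>
    also have "\<dots> \<le> (\<Sum>n \<in> ?F. real n powr (-1/4))"
      by (intro sum_mono powr_mono2') auto
    also have "\<dots> \<le> (\<Prod>p \<in> A. ?g p)"
      using A by (intro sum_fourth_root_le) (auto simp: r rad_eq_iff A_def)
    also have "\<dots> \<le> (\<Prod>p \<in> A. if p < 16 then ?D else 1)"
      using A fac by (intro prod_mono) auto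
    also have "\<dots> = ?D ^ card (A \<inter> {..<16})"
      using A by (simp add: prod.If_cases lessThan_def)
    also have "\<dots> \<le> ?D ^ 16"
      using card_mono[of "{..<16::nat}" "A \<inter> {..<16}"] by (intro power_increasing) auto
    finally have "real (card ?F) * real x powr (-1/4) \<le> ?D ^ 16" .
    then show ?thesis using \<open>0 < n0\<close> \<open>n0 \<le> x\<close>
      by (simp add: powr_minus field_simps)
  next
    case True
    show ?thesis unfolding True by simp
  qed
qed

section \<open>Linear bound on the number of inspected pairs\<close>

text \<open>A list walk also meets entries m \<ge> n, so there is no condition m < n: the set
  measures work, not output.\<close>

definition visited :: "nat \<Rightarrow> nat \<Rightarrow> (nat \<times> nat) set" where
  "visited S b = {(m, n). 0 < m \<and> m < S \<and> good S m \<and> 0 < n \<and> n < S \<and> good S n \<and>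
     rad m = rad (n + b)}"

lemma finite_visited: "finite (visited S b)"
  by (rule finite_subset[of _ "{..<S} \<times> {..<S}"]) (auto simp: visited_def)

lemma card_visited_bound:
  "\<exists>K > 0. \<forall>S > 0. \<forall>b. real (card (visited S b)) \<le> K * real S"
proof -
  obtain C where C: "0 < C"
    and *: "\<And>x r. real (card {n. 0 < n \<and> n \<le> x \<and> rad n = r}) \<le> C * real x powr (1/4)"
    using card_rad_eq_bound by (elim exE conjE) (rule that, assumption, simp only:)
  have "real (card (visited S b)) \<le> (4 * C\<^sup>2) * real S" if S: "0 < S" for S b
  proof -
    let ?N = "\<lambda>r. {n. 0 < n \<and> n \<le> S \<and> rad n = r}"
    let ?q = "real S powr (1/4)"
    define R where "R = {r. 0 < r \<and> r * r \<le> 2 * S}"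
    define G where "G = {n. 0 < n \<and> n < S \<and> good S n}"
    define H where "H = (\<Union>r \<in> R. ?N r)"
    have "R \<subseteq> {..2 * S}"
      by (auto simp: R_def) (metis le_square le_trans)
    then have finR: "finite R" by (rule finite_subset) simp
    have cardR: "real (card R) \<le> 2 * ?q ^ 2"
    proof (cases "R = {}")
      case False
      then have "Max R \<in> R" using finR by simp
      have "R \<subseteq> {1..Max R}" using finR by (auto simp: R_def Suc_le_eq)
      then have "card R \<le> Max R" using card_mono[of "{1..Max R}" R] by simp
      then have "real (card R) ^ 2 \<le> real (Max R) ^ 2" by (simp add: power_mono)
      also have "\<dots> = real (Max R * Max R)" by (simp add: power2_eq_square)
      also have "\<dots> \<le> real (2 * S)"
        using \<open>Max R \<in> R\<close> unfolding R_def mem_Collect_eq of_nat_le_iff by blast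
      also have "\<dots> \<le> (2 * ?q ^ 2) ^ 2"
        using S by (simp add: power_mult_distrib powr_power)
      finally show ?thesis by (rule power2_le_imp_le) simp
    qed simp
    have cardN: "real (card (?N r)) \<le> C * ?q" for r by (rule *)
    have finN: "finite (?N r)" for r by simp
    have "real (card H) \<le> real (\<Sum>r \<in> R. card (?N r))"
      unfolding H_def using finR by (intro of_nat_mono card_UN_le)
    also have "\<dots> \<le> (\<Sum>r \<in> R. C * ?q)"
      unfolding of_nat_sum by (intro sum_mono cardN)
    also have "\<dots> \<le> 2 * ?q ^ 2 * (C * ?q)"
      using cardR C by (simp add: mult_right_mono)
    finally have cardH: "real (card H) \<le> 2 * C * ?q ^ 3"
      by (simp add: power2_eq_square power3_eq_cube mult_ac)
    have finH: "finite H" using finR by (simp add: H_def)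
    \<comment> \<open>The square of the smaller factor is at most the product. \<open>?N\<close>
      includes the endpoint S so that \<open>Suc n\<close> qualifies.\<close>
    have "n \<in> H \<or> Suc n \<in> H" if "n \<in> G" for n
    proof -
      have "rad n * rad n \<le> 2 * S \<or> rad (Suc n) * rad (Suc n) \<le> 2 * S"
        using that mult_le_mono2[of "rad n" "rad (Suc n)" "rad n"]
          mult_le_mono1[of "rad (Suc n)" "rad n" "rad (Suc n)"]
        unfolding G_def good_def mem_Collect_eq by linarith
      then show ?thesis using that by (auto simp: H_def R_def G_def rad_pos)
    qed
    then have "G \<subseteq> H \<union> (\<lambda>n. n - 1) ` H" by force
    then have "card G \<le> card (H \<union> (\<lambda>n. n - 1) ` H)" using finH by (intro card_mono) auto
    also have "\<dots> \<le> card H + card H"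
      using card_Un_le[of H] card_image_le[OF finH, of "\<lambda>n. n - 1"] by (meson add_left_mono le_trans)
    finally have "real (card G) \<le> 2 * real (card H)" by simp
    with cardH have cardG: "real (card G) \<le> 4 * C * ?q ^ 3" by simp
    have "visited S b \<subseteq> (\<lambda>(n, m). (m, n)) ` (SIGMA n:G. ?N (rad (n + b)))"
      by (auto simp: visited_def G_def image_iff)
    then have "card (visited S b) \<le> card (SIGMA n:G. ?N (rad (n + b)))"
      by (rule surj_card_le[rotated]) (auto simp: G_def)
    also have "\<dots> = (\<Sum>n \<in> G. card (?N (rad (n + b))))"
      by (rule card_SigmaI) (auto simp: G_def)
    finally have "real (card (visited S b)) \<le> real (\<Sum>n \<in> G. card (?N (rad (n + b))))"
      by (simp only: of_nat_le_iff)
    also have "\<dots> \<le> (\<Sum>n \<in> G. C * ?q)"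
      unfolding of_nat_sum by (intro sum_mono cardN)
    also have "\<dots> \<le> (4 * C * ?q ^ 3) * (C * ?q)"
      using cardG C by (simp add: mult_right_mono)
    also have "\<dots> = 4 * C\<^sup>2 * ?q ^ 4" by (simp add: power2_eq_square eval_nat_numeral)
    also have "?q ^ 4 = real S" using S by (simp add: powr_power)
    finally show ?thesis .
  qed
  moreover have "0 < 4 * C\<^sup>2" using C by simp
  ultimately show ?thesis by blast
qed

text \<open>The cost of the sieve, as \<open>i\<close> has \<open>S div i\<close> multiples up to
  \<open>S\<close>. Charging every \<open>i\<close>, not only the primes, still stays within S log
  S.\<close>

lemma sum_div_le:
  assumes "0 < S"
  shows "real (\<Sum>i = 1..S. S div i) \<le> real S * (1 + ln (real S))"
proof -
  have harm: "(\<Sum>i = 1..n. 1 / real i) \<le> 1 + ln (real n)" if "0 < n" for n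
    using that
  proof (induction n rule: nat_induct_non_zero)
    case (Suc n)
    have "ln (real n / real (Suc n)) \<le> real n / real (Suc n) - 1"
      using Suc.hyps by (intro ln_le_minus_one) simp
    also have "\<dots> = - (1 / real (Suc n))" by (simp add: field_simps)
    finally have "1 / real (Suc n) \<le> ln (real (Suc n)) - ln (real n)"
      using Suc.hyps by (simp add: ln_div)
    with Suc.IH show ?case by simp
  qed simp
  have "real (\<Sum>i = 1..S. S div i) \<le> (\<Sum>i = 1..S. real S * (1 / real i))"
    unfolding of_nat_sum by (intro sum_mono) (simp add: of_nat_div_le_of_nat)
  also have "\<dots> \<le> real S * (1 + ln (real S))"
    unfolding sum_distrib_left[symmetric] using harm[OF assms] by (simp add: mult_left_mono)
  finally show ?thesis .
qed

section \<open>The program\<close>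

definition bucket :: "nat \<Rightarrow> nat \<Rightarrow> nat \<Rightarrow> nat set" where
  "bucket S r x = {m. 0 < m \<and> m < x \<and> good S m \<and> rad m = r}"

text \<open>The 0 for an empty bucket doubles as end marker, since list entries are positive.
  \<open>prev S r x\<close> is the head of list \<open>r\<close> once all numbers below
  \<open>x\<close> are inserted, and \<open>prev S (rad m) m\<close> the successor of
  \<open>m\<close>.\<close>

definition prev :: "nat \<Rightarrow> nat \<Rightarrow> nat \<Rightarrow> nat" where
  "prev S r x = Max (insert 0 (bucket S r x))"

lemma finite_bucket [simp]: "finite (bucket S r x)"
  by (rule finite_subset[of _ "{..<x}"]) (auto simp: bucket_def)

text \<open>The nil/cons split of a linked list: behind the head lies the bucket below it.\<close>

lemma prev_cases:
  obtains "prev S r x = 0" and "bucket S r x = {}"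
  | "0 < prev S r x" and "prev S r x < x" and "good S (prev S r x)" and "rad (prev S r x) = r"
    and "bucket S r x = insert (prev S r x) (bucket S r (prev S r x))"
proof (cases "prev S r x = 0")
  case True
  have "m \<le> prev S r x" if "m \<in> bucket S r x" for m
    unfolding prev_def using that by (intro Max_ge) auto
  with True have "bucket S r x = {}" by (force simp: bucket_def)
  with True show ?thesis by (rule that(1))
next
  case False
  have "prev S r x \<in> insert 0 (bucket S r x)"
    unfolding prev_def by (rule Max_in) auto
  with False have b: "prev S r x \<in> bucket S r x" by simp
  have "m \<le> prev S r x" if "m \<in> bucket S r x" for m
    unfolding prev_def using that by (intro Max_ge) auto
  with b have "bucket S r x = insert (prev S r x) (bucket S r (prev S r x))"
    by (auto simp: bucket_def order.order_iff_strict)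
  with b show ?thesis by (intro that(2)) (auto simp: bucket_def)
qed

lemma prev_1: "prev S r (Suc 0) = 0"
  by (rule prev_cases[of S r "Suc 0"]) auto

lemma prev_Suc:
  assumes "0 < n"
  shows "prev S r (Suc n) = (if good S n \<and> rad n = r then n else prev S r n)"
proof (cases "good S n \<and> rad n = r")
  case True
  have "prev S r (Suc n) = n"
    unfolding prev_def by (rule Max_eqI) (use True assms in \<open>auto simp: bucket_def\<close>)
  with True show ?thesis by simp
next
  case False
  then have "bucket S r (Suc n) = bucket S r n" by (auto simp: bucket_def less_Suc_eq)
  with False show ?thesis by (auto simp: prev_def)
qed

text \<open>The content of table entry \<open>k\<close> when the sieve arrives at
  \<open>i\<close>.\<close>

definition sieved :: "nat \<Rightarrow> nat \<Rightarrow> nat" where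
  "sieved i k = \<Prod>{p. prime p \<and> p < i \<and> p dvd k}"

lemma finite_sieved: "finite {p::nat. prime p \<and> p < i \<and> p dvd k}"
  by (rule finite_subset[of _ "{..<i}"]) auto

lemma sieved_2: "sieved 2 k = 1"
proof -
  have "{p::nat. prime p \<and> p < 2 \<and> p dvd k} = {}" by (auto dest!: prime_ge_2_nat)
  then show ?thesis unfolding sieved_def by (simp only: prod.empty)
qed

lemma sieved_Suc: "sieved (Suc i) k = sieved i k * (if prime i \<and> i dvd k then i else 1)"
proof -
  have "{p. prime p \<and> p < Suc i \<and> p dvd k} =
    (if prime i \<and> i dvd k then insert i {p. prime p \<and> p < i \<and> p dvd k}
     else {p. prime p \<and> p < i \<and> p dvd k})"
    by (auto simp: less_Suc_eq)
  then show ?thesis using finite_sieved[of i k] by (simp add: sieved_def)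
qed

lemma sieved_le: "0 < k \<Longrightarrow> sieved i k \<le> k"
  unfolding sieved_def by (intro dvd_imp_le prod_primes_dvd finite_sieved) auto

lemma sieved_eq_rad:
  assumes "0 < k" "k < i"
  shows "sieved i k = rad k"
proof -
  have "{p. prime p \<and> p < i \<and> p dvd k} = prime_factors k"
    using assms by (auto simp: prime_factors_dvd dest: dvd_imp_le)
  then show ?thesis by (simp add: sieved_def rad_def)
qed

text \<open>The radical table doubles as primality test: a composite has a smaller prime divisor,
  already multiplied into its entry, while the entry of a prime is still 1.\<close>

lemma one_less_sieved_iff:
  assumes "2 \<le> i"
  shows "1 < sieved i i \<longleftrightarrow> \<not> prime i"
proof
  assume "1 < sieved i i"
  then have "{p. prime p \<and> p < i \<and> p dvd i} \<noteq> {}"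
    unfolding sieved_def by (metis less_irrefl prod.empty)
  then show "\<not> prime i" using primes_dvd_imp_eq by blast
next
  assume "\<not> prime i"
  obtain p where p: "prime p" "p dvd i" using assms prime_factor_nat[of i] by auto
  with \<open>\<not> prime i\<close> assms have "p < i" by (metis dvd_imp_le le_neq_implies_less less_le_trans pos2)
  with p have "p dvd sieved i i"
    unfolding sieved_def by (intro dvd_prodI[of _ p "\<lambda>p. p", simplified] finite_sieved) simp
  moreover have "0 < sieved i i" unfolding sieved_def by (auto intro: prod_pos prime_gt_0_nat)
  ultimately have "p \<le> sieved i i" by (rule dvd_imp_le)
  then show "1 < sieved i i" using prime_gt_1_nat[OF p(1)] by linarith
qed

lemma pairs_at_upd [simp]:
  "a < p \<or> p + 2 * k \<le> a \<Longrightarrow> pairs_at (M(a := x)) p k = pairs_at M p k"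
  by (auto simp: pairs_at_def)

lemma pairs_at_Suc: "pairs_at M p (Suc k) = pairs_at M p k @ [(M (p + 2 * k), M (Suc (p + 2 * k)))]"
  by (simp add: pairs_at_def)

lemma length_pairs_at [simp]: "length (pairs_at M p k) = k"
  by (simp add: pairs_at_def)

text \<open>
  Cell 4 holds S, cells 5, 6 and 7 the base addresses of three tables, cell 9 the number 2S, cell 14
  the end of the output written so far and cell 15 the number b of the current pass; cell 18 is
  never written and thus 0. Labels in the program are positions of jump targets.

  The first table contains the radicals. The other two represent, for each r, the linked list of the
  numbers m with radical r and rad m * rad (m + 1) <= 2S in decreasing order: the second contains
  the heads of the lists, the third the successors, and 0 ends a list. Pass b walks, for each such
  number n, through the list of rad (n + b).
\<close>

definition benelux_program :: program where
  "benelux_program =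
   [Move 4 0, Const 8 1, Const 5 20, Add 6 5 4, Add 6 6 8, Add 7 6 4, Add 7 7 8, Add 14 7 4,
    Add 14 14 8, Move 0 14, Add 9 4 4,
    \<comment> \<open>11: initialise the radicals by 1\<close>
    JumpLess 4 10 16, Add 12 5 10, Store 12 8, Add 10 10 8, Jump 11,
    \<comment> \<open>16: a number not hit by smaller primes is prime, and is multiplied into its multiples\<close>
    Add 10 8 8,
    \<comment> \<open>17\<close>
    JumpLess 4 10 31, Add 12 5 10, Load 13 12, JumpLess 8 13 29, Move 11 10,
    \<comment> \<open>22\<close>
    JumpLess 4 11 29, Add 12 5 11, Load 13 12, Mult 13 13 10, Store 12 13, Add 11 11 10, Jump 22,
    \<comment> \<open>29\<close>
    Add 10 10 8, Jump 17,
    \<comment> \<open>31: build the linked lists\<close>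
    Move 10 8,
    \<comment> \<open>32\<close>
    JumpEq 10 4 46, Add 12 5 10, Load 11 12, Add 12 12 8, Load 13 12, Mult 13 11 13,
    JumpLess 9 13 44, Add 12 6 11, Load 13 12, Add 17 7 10, Store 17 13, Store 12 10,
    \<comment> \<open>44\<close>
    Add 10 10 8, Jump 32,
    \<comment> \<open>46: a pass, with n in cell 10\<close>
    Move 2 14, Const 3 0, Move 10 8,
    \<comment> \<open>49\<close>
    JumpEq 10 4 79, Add 12 5 10, Add 12 12 15, Load 11 12, Add 12 5 10, Add 12 12 8,
    Sub 12 12 15, Load 17 12, Mult 13 11 17, JumpLess 9 13 77, Add 12 6 11, Load 16 12,
    \<comment> \<open>61: walk through a list, with m in cell 16 and rad (n + 1 - b) in cell 17\<close>
    JumpEq 16 18 77, Add 12 5 16, Add 12 12 8, Load 13 12, JumpEq 13 17 67, Jump 74,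
    \<comment> \<open>67\<close>
    JumpLess 16 10 69, Jump 74,
    \<comment> \<open>69\<close>
    Store 14 16, Add 14 14 8, Store 14 10, Add 14 14 8, Add 3 3 8,
    \<comment> \<open>74\<close>
    Add 12 7 16, Load 16 12, Jump 61,
    \<comment> \<open>77\<close>
    Add 10 10 8, Jump 49,
    \<comment> \<open>79\<close>
    JumpEq 15 8 84, Move 0 2, Move 1 3, Move 15 8, Jump 46]"

lemma length_benelux_program [simp]: "length benelux_program = 84"
  by (simp add: benelux_program_def)

text \<open>Unfolds the program only under \<open>!\<close>, so that it stays folded in the
  \<open>reaches\<close> goals.\<close>

lemmas benelux_program_nth = arg_cong[OF benelux_program_def, of "\<lambda>P. P ! pc" for pc]

section \<open>Memory layout and frame rules\<close>

text \<open>Each table has S + 1 cells for the indices 0 to S, whence the bases 20, 21 + S and 22 +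
  2S; the output starts at 23 + 3S.\<close>

definition consts_ok :: "nat \<Rightarrow> memory \<Rightarrow> bool" where
  "consts_ok S M \<longleftrightarrow> M 4 = S \<and> M 5 = 20 \<and> M 6 = 21 + S \<and> M 7 = 22 + 2 * S \<and> M 8 = 1 \<and>
     M 9 = 2 * S \<and> M 18 = 0"

definition no_output :: "nat \<Rightarrow> memory \<Rightarrow> bool" where
  "no_output S M \<longleftrightarrow> consts_ok S M \<and> M 0 = 23 + 3 * S \<and> M 1 = 0 \<and> M 14 = 23 + 3 * S \<and> M 15 = 0"

definition heads :: "nat \<Rightarrow> (nat \<Rightarrow> nat) \<Rightarrow> memory \<Rightarrow> bool" where
  "heads S h M \<longleftrightarrow> (\<forall>r \<le> S. M (21 + S + r) = h r)"

definition rads :: "nat \<Rightarrow> (nat \<Rightarrow> nat) \<Rightarrow> memory \<Rightarrow> bool" where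
  "rads S f M \<longleftrightarrow> (\<forall>k. 0 < k \<longrightarrow> k \<le> S \<longrightarrow> M (20 + k) = f k)"

definition nexts :: "nat \<Rightarrow> nat \<Rightarrow> memory \<Rightarrow> bool" where
  "nexts S n M \<longleftrightarrow>
     (\<forall>m. 0 < m \<longrightarrow> m < n \<longrightarrow> good S m \<longrightarrow> M (22 + 2 * S + m) = prev S (rad m) m)"

lemma consts_ok_upd [simp]:
  "10 \<le> a \<and> a \<le> 17 \<or> 20 \<le> a \<or> a < 4 \<Longrightarrow> consts_ok S (M(a := x)) \<longleftrightarrow> consts_ok S M"
  by (auto simp: consts_ok_def)

lemma no_output_upd [simp]:
  "10 \<le> a \<and> a \<le> 13 \<or> 16 \<le> a \<and> a \<le> 17 \<or> 20 \<le> a \<Longrightarrow>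
    no_output S (M(a := x)) \<longleftrightarrow> no_output S M"
  by (auto simp: no_output_def)

lemma heads_upd [simp]:
  "a < 21 + S \<or> 21 + 2 * S < a \<Longrightarrow> heads S h (M(a := x)) \<longleftrightarrow> heads S h M"
  unfolding heads_def by (intro all_cong1 imp_cong refl) auto

lemma rads_upd [simp]:
  "a \<le> 20 \<or> 20 + S < a \<Longrightarrow> rads S f (M(a := x)) \<longleftrightarrow> rads S f M"
  unfolding rads_def by (intro all_cong1 imp_cong refl) auto

lemma nexts_upd [simp]:
  "a \<le> 22 + 2 * S \<or> 22 + 2 * S + n \<le> a \<Longrightarrow> nexts S n (M(a := x)) \<longleftrightarrow> nexts S n M"
  unfolding nexts_def by (intro all_cong1 imp_cong refl) auto

lemma radsD: "rads S f M \<Longrightarrow> 0 < k \<Longrightarrow> k \<le> S \<Longrightarrow> M (20 + k) = f k"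
  by (simp add: rads_def)

lemma headsD: "heads S h M \<Longrightarrow> r \<le> S \<Longrightarrow> M (21 + S + r) = h r"
  by (simp add: heads_def)

lemma nextsD:
  "nexts S n M \<Longrightarrow> 0 < m \<Longrightarrow> m < n \<Longrightarrow> good S m \<Longrightarrow> M (22 + 2 * S + m) = prev S (rad m) m"
  by (simp add: nexts_def)

definition tables :: "nat \<Rightarrow> memory \<Rightarrow> bool" where
  "tables S M \<longleftrightarrow>
     consts_ok S M \<and> rads S rad M \<and> heads S (\<lambda>r. prev S r S) M \<and> nexts S S M"

lemma tables_upd [simp]:
  "10 \<le> a \<and> a \<le> 17 \<or> a < 4 \<or> 22 + 3 * S \<le> a \<Longrightarrow> tables S (M(a := x)) \<longleftrightarrow> tables S M"
  by (elim disjE) (auto simp: tables_def)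

text \<open>\<open>ys\<close> is the finished list of an earlier pass, \<open>xs\<close> the list
  being written from \<open>p\<close> on. Both passes write through cells 2 and 3; the first result
  is then moved to cells 0 and 1.\<close>

definition outputs ::
  "nat \<Rightarrow> (nat \<times> nat) list \<Rightarrow> nat \<Rightarrow> (nat \<times> nat) list \<Rightarrow> memory \<Rightarrow> bool" where
  "outputs S ys p xs M \<longleftrightarrow> 23 + 3 * S \<le> M 0 \<and> M 0 + 2 * M 1 \<le> p \<and> M 2 = p \<and>
     M 3 = length xs \<and> M 14 = p + 2 * length xs \<and>
     pairs_at M (M 0) (M 1) = ys \<and> pairs_at M p (length xs) = xs"

lemma outputs_upd [simp]:
  "10 \<le> a \<and> a \<le> 13 \<or> 15 \<le> a \<and> a < 20 \<Longrightarrow> outputs S ys p xs (M(a := x)) \<longleftrightarrow> outputs S ys p xs M"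
  by (auto simp: outputs_def)

text \<open>For b \<le> 1 the numbers \<open>n + b\<close> and \<open>Suc n - b\<close> are n and n
  + 1 in one order or the other, so one formula serves both kinds.\<close>

definition hits :: "nat \<Rightarrow> nat \<Rightarrow> (nat \<times> nat) set" where
  "hits S b = {(m, n) \<in> visited S b. m < n \<and> rad (Suc m) = rad (Suc n - b)}"

lemma hits_0: "hits S 0 = {(m, n). benelux_pair m n \<and> n < S}"
  by (auto simp: hits_def visited_def benelux_pair_iff)

lemma hits_1: "hits S 1 = {(m, n). benelux_pair2 m n \<and> n < S}"
  by (auto simp: hits_def visited_def benelux_pair2_iff)

text \<open>
  On an eta-expanded memory fun_upd_apply rewrites under the binder, after which the frame rules
  above no longer match.
\<close>

declare fun_upd_apply [simp del] fun_upd_same [simp] fun_upd_other [simp]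

lemma outputs_append [simp]:
  assumes "outputs S ys p xs M"
  shows "outputs S ys p (xs @ [(m, n)]) (M(p + 2 * length xs := m,
    Suc (p + 2 * length xs) := n, 14 := Suc (Suc (p + 2 * length xs)), 3 := Suc (length xs)))"
  using assms by (auto simp: outputs_def pairs_at_Suc)

section \<open>Verification of the program phases\<close>

text \<open>Cells hold addresses, whence \<open>s \<le> v\<close>, and products of two radicals,
  each at most S, are formed before being compared with 2S.\<close>

locale resources =
  fixes S s v :: nat
  assumes S: "2 \<le> S" and s: "23 + 3 * S \<le> s" and v: "s \<le> v" "S * S + 2 * S \<le> v"
begin

abbreviation reach :: "nat \<Rightarrow> config \<Rightarrow> (config \<Rightarrow> bool) \<Rightarrow> bool" where
  "reach \<equiv> reaches benelux_program s v"

text \<open>In this and the later counting loops \<open>d\<close> is the number of rounds left, its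
  coefficient bounds the instructions of a round, and the final 1 pays for the exit test. The head
  table is never cleared by the program: its zeros come from the initial memory and are carried
  along until the lists are built.\<close>

lemma reach_init:
  assumes "n + d = Suc S" "bounded v M" "no_output S M" "heads S (\<lambda>_. 0) M" "M 10 = n"
    "\<forall>k < n. M (20 + k) = 1"
  shows "reach (5 * d + 1) (11, M)
    (\<lambda>(pc, M). pc = 16 \<and> no_output S M \<and> heads S (\<lambda>_. 0) M \<and> rads S (sieved 2) M)"
  using assms
proof (induction d arbitrary: n M)
  case 0
  then have c: "M 4 = S" by (auto simp: no_output_def consts_ok_def)
  show ?case
    apply (rule reaches_block[where k = 1 and T = 0])
    using 0 c S s v apply (simp add: benelux_program_nth)
      apply (rule reaches_refl)
    using 0 by (auto simp: rads_def sieved_2)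
next
  case (Suc d)
  then have c: "M 4 = S" "M 5 = 20" "M 8 = 1" by (auto simp: no_output_def consts_ok_def)
  show ?case
    apply (rule reaches_block[where k = 5 and T = "5 * d + 1"])
    using Suc.prems c S s v apply (simp add: benelux_program_nth)
      apply (rule reaches_mono, rule Suc.IH[of "Suc n"])
    using Suc.prems c S s v
    apply simp_all
    by (auto simp: less_Suc_eq fun_upd_apply)
qed

text \<open>Multiples of \<open>i\<close> below \<open>j\<close> already contain the factor
  \<open>i\<close>. The number \<open>c\<close> only bounds the rounds left, so the loop may exit
  before it is used up.\<close>

lemma reach_multiples:
  assumes "prime i" "i \<le> S" "i dvd j" "0 < j" "S < j + i * c" "bounded v M"
    "no_output S M" "heads S (\<lambda>_. 0) M" "M 10 = i" "M 11 = j"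
    "rads S (\<lambda>k. sieved i k * (if i dvd k \<and> k < j then i else 1)) M"
  shows "reach (7 * c + 1) (22, M) (\<lambda>(pc, M). pc = 29 \<and> no_output S M \<and> heads S (\<lambda>_. 0) M \<and>
    M 10 = i \<and> rads S (sieved (Suc i)) M)"
  using assms
proof (induction c arbitrary: j M)
  case 0
  then have c: "M 4 = S" by (auto simp: no_output_def consts_ok_def)
  show ?case
    apply (rule reaches_block[where k = 1 and T = 0])
    using 0 c S s v apply (simp add: benelux_program_nth)
      apply (rule reaches_refl)
    using 0 by (auto simp: rads_def sieved_Suc)
next
  case (Suc c)
  then have c: "M 4 = S" "M 5 = 20" "M 8 = 1" by (auto simp: no_output_def consts_ok_def)
  show ?case
  proof (cases "S < j")
    case True
    show ?thesis
      apply (rule reaches_block[where k = 1 and T = 0])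
      using Suc.prems c S s v True apply (simp add: benelux_program_nth)
        apply (rule reaches_refl)
      using Suc.prems True by (auto simp: rads_def sieved_Suc)
  next
    case False
    have *: "i dvd k \<and> k < j + i \<longleftrightarrow> k = j \<or> i dvd k \<and> k < j" for k
    proof -
      have "0 < i" using Suc.prems(1) by (rule prime_gt_0_nat)
      from Suc.prems(3) obtain a where a: "j = i * a" ..
      have *: "i * b < i * a + i \<longleftrightarrow> i * b = i * a \<or> i * b < i * a" for b
        using \<open>0 < i\<close> mult_less_cancel1[of i b "Suc a"] by (auto simp: less_Suc_eq)
      show ?thesis
      proof (cases "i dvd k")
        case True
        then obtain b where "k = i * b" ..
        with a * show ?thesis by simp
      qed (use Suc.prems(3) in auto)
    qed
    \<comment> \<open>The new entry is \<open>sieved (Suc i) j\<close>, a divisor of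
      \<open>j\<close>, so the product does not exceed \<open>S\<close>.\<close>
    have r: "M (20 + j) = sieved i j" and le: "sieved i j * i \<le> S" "sieved i j \<le> S"
      using Suc.prems False sieved_le[of j "Suc i"] sieved_le[of j i]
      by (auto simp: rads_def sieved_Suc)
    show ?thesis
      apply (rule reaches_block[where k = 7 and T = "7 * c + 1"])
      using Suc.prems c S s v r le False apply (simp add: benelux_program_nth)
        apply (rule reaches_mono, rule Suc.IH[of "j + i"])
      using Suc.prems c S s v r le False
      apply simp_all
      by (auto simp: rads_def * fun_upd_apply)
  qed
qed

lemma reach_sieve:
  assumes "i + d = Suc S" "2 \<le> i" "bounded v M" "no_output S M" "heads S (\<lambda>_. 0) M"
    "M 10 = i" "rads S (sieved i) M"
  shows "reach ((\<Sum>l = i..S. 7 * (S div l) + 9) + 1) (17, M)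
    (\<lambda>(pc, M). pc = 31 \<and> no_output S M \<and> heads S (\<lambda>_. 0) M \<and> rads S rad M)"
  using assms
proof (induction d arbitrary: i M)
  case 0
  then have c: "M 4 = S" by (auto simp: no_output_def consts_ok_def)
  show ?case
    apply (rule reaches_block[where k = 1 and T = 0])
    using 0 c S s v apply (simp add: benelux_program_nth)
      apply (rule reaches_refl)
    using 0 by (auto simp: rads_def sieved_eq_rad)
next
  case (Suc d)
  then have c: "M 4 = S" "M 5 = 20" "M 8 = 1" by (auto simp: no_output_def consts_ok_def)
  let ?Q = "\<lambda>(pc, M). pc = 31 \<and> no_output S M \<and> heads S (\<lambda>_. 0) M \<and> rads S rad M"
  have iS: "i \<le> S" using Suc.prems by simp
  have T: "(\<Sum>l = i..S. 7 * (S div l) + 9) =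
    (7 * (S div i) + 9) + (\<Sum>l = Suc i..S. 7 * (S div l) + 9)"
    using iS by (rule sum.atLeast_Suc_atMost)
  have next_i: "reach ((\<Sum>l = Suc i..S. 7 * (S div l) + 9) + 3) (29, M') ?Q"
    if M': "no_output S M'" "heads S (\<lambda>_. 0) M'" "M' 10 = i" "rads S (sieved (Suc i)) M'"
      "bounded v M'" for M'
  proof -
    have c': "M' 8 = 1" using M' by (auto simp: no_output_def consts_ok_def)
    show ?thesis
      apply (rule reaches_block[where k = 2 and T = "(\<Sum>l = Suc i..S. 7 * (S div l) + 9) + 1"])
      using M' c' S s v iS apply (simp add: benelux_program_nth)
        apply (rule reaches_mono, rule Suc.IH[of "Suc i"])
      using M' Suc.prems(1,2) S s v by simp_all
  qed
  have r: "M (20 + i) = sieved i i" and le: "sieved i i \<le> S"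
    using Suc.prems sieved_le[of i i] by (auto simp: rads_def)
  show ?case
  proof (cases "prime i")
    case False
    then have sv: "1 < sieved i i" using one_less_sieved_iff Suc.prems by blast
    show ?thesis
      unfolding T
      apply (rule reaches_block[where k = 4 and T = "(\<Sum>l = Suc i..S. 7 * (S div l) + 9) + 3"])
      using Suc.prems c S s v r le sv iS apply (simp add: benelux_program_nth)
        apply (rule reaches_mono, rule next_i)
      using Suc.prems c S s v False
      apply simp_all
      by (auto simp: rads_def sieved_Suc fun_upd_apply)
  next
    case True
    then have sv: "\<not> 1 < sieved i i" using one_less_sieved_iff Suc.prems by blast
    have "S < i + i * (S div i)"
      using dividend_less_times_div[of i S] Suc.prems by simp
    show ?thesis
      unfolding T
      apply (rule reaches_block[where k = 5 and
            T = "7 * (S div i) + 1 + ((\<Sum>l = Suc i..S. 7 * (S div l) + 9) + 3)"])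
      using Suc.prems c S s v r le sv iS apply (simp add: benelux_program_nth)
        apply (rule reaches_trans)
          apply (rule reach_multiples[of i i "S div i"])
      using \<open>S < i + i * (S div i)\<close> True Suc.prems c S s v iS apply simp_all
        \<comment> \<open>At the start j = i, and no positive multiple of \<open>i\<close> lies
          below \<open>i\<close>.\<close>
        apply (use Suc.prems in \<open>auto simp: rads_def dest!: dvd_imp_le\<close>)[1]
       apply (rule next_i)
      by auto
  qed
qed

text \<open>Pushing \<open>n\<close> to the front of its list: the old head becomes its successor,
  and \<open>prev_Suc\<close> describes the new head.\<close>

lemma reach_build:
  assumes "n + d = S" "0 < n" "bounded v M" "no_output S M" "rads S rad M"
    "heads S (\<lambda>r. prev S r n) M" "nexts S n M" "M 10 = n"
  shows "reach (14 * d + 1) (32, M) (\<lambda>(pc, M). pc = 46 \<and> no_output S M \<and> tables S M)"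
  using assms
proof (induction d arbitrary: n M)
  case 0
  then have c: "M 4 = S" "consts_ok S M" by (auto simp: no_output_def consts_ok_def)
  show ?case
    apply (rule reaches_block[where k = 1 and T = 0])
    using 0 c S s v apply (simp add: benelux_program_nth)
      apply (rule reaches_refl)
    using 0 c by (auto simp: tables_def)
next
  case (Suc d)
  then have c: "M 4 = S" "M 5 = 20" "M 6 = 21 + S" "M 7 = 22 + 2 * S" "M 8 = 1" "M 9 = 2 * S"
    by (auto simp: no_output_def consts_ok_def)
  have r: "M (20 + n) = rad n" "M (Suc (20 + n)) = rad (Suc n)"
    using radsD[OF Suc.prems(5), of n] radsD[OF Suc.prems(5), of "Suc n"] Suc.prems(1,2) by auto
  have le: "rad n \<le> S" "rad (Suc n) \<le> S"
    using rad_le[of n] rad_le[of "Suc n"] Suc.prems by auto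
  then have le': "rad n * rad (Suc n) \<le> v" using mult_le_mono v(2) by fastforce
  have h: "M (21 + S + rad n) = prev S (rad n) n" "prev S (rad n) n \<le> v"
    using headsD[OF Suc.prems(6) le(1)] boundedD[OF Suc.prems(3), of "21 + S + rad n"] by auto
  show ?case
  proof (cases "good S n")
    case False
    then have "2 * S < rad n * rad (Suc n)" by (simp add: good_def)
    then show ?thesis
      apply -
      apply (rule reaches_block[where k = 9 and T = "14 * d + 1"])
      using Suc.prems c S s v r le le' apply (simp add: benelux_program_nth)
        apply (rule reaches_mono, rule Suc.IH[of "Suc n"])
      using Suc.prems c S s v apply simp_all
      using False by (auto simp: heads_def prev_Suc nexts_def less_Suc_eq)
  next
    case True
    then have "\<not> 2 * S < rad n * rad (Suc n)" by (simp add: good_def)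
    then show ?thesis
      apply -
      apply (rule reaches_block[where k = 14 and T = "14 * d + 1"])
      using Suc.prems c S s v r le le' h apply (simp add: benelux_program_nth)
        apply (rule reaches_mono, rule Suc.IH[of "Suc n"])
      using Suc.prems c S s v le apply simp_all
      using True by (auto simp: heads_def prev_Suc nexts_def less_Suc_eq fun_upd_apply)
  qed
qed

text \<open>\<open>bucket S r x\<close> is the unread rest of the list. Entries decrease, so pairs
  still to be emitted for \<open>n\<close> differ from those in \<open>xs\<close>, which keeps the
  output distinct. Every entry, hit or not, is granted two output cells and the 14 instructions of
  the hit path.\<close>

lemma reach_walk:
  assumes "bounded v M" "tables S M" "outputs S ys p xs M" "M 15 = b" "M 10 = n" "M 17 = q"
    "M 16 = prev S r x" "x \<le> S" "n < S" "distinct xs" "\<forall>k < x. (k, n) \<notin> set xs"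
    "p + 2 * (length xs + card (bucket S r x)) \<le> s"
    "A = set xs \<union> (\<lambda>k. (k, n)) ` {k \<in> bucket S r x. k < n \<and> rad (Suc k) = q}"
  shows "reach (14 * card (bucket S r x) + 1) (61, M) (\<lambda>(pc, M). pc = 77 \<and> tables S M \<and>
    M 15 = b \<and> M 10 = n \<and> (\<exists>zs. outputs S ys p zs M \<and> distinct zs \<and> set zs = A))"
  using assms
proof (induction x arbitrary: M xs rule: less_induct)
  case (less x)
  then have c: "M 5 = 20" "M 7 = 22 + 2 * S" "M 8 = 1" "M 18 = 0"
    by (auto simp: tables_def consts_ok_def)
  show ?case
  proof (cases rule: prev_cases[of S r x])
    case 1
    then show ?thesis
      apply -
      apply (rule reaches_block[where k = 1 and T = 0])
      using less.prems c S s v apply (simp add: benelux_program_nth)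
        apply (rule reaches_refl)
      using less.prems by auto
  next
    case 2
    define m where "m = prev S r x"
    define B where "B = bucket S r m"
    note m = 2[folded m_def, folded B_def]
    have card: "card (bucket S r x) = Suc (card B)"
      unfolding m(5) by (subst card_insert_disjoint) (auto simp: B_def bucket_def)
    have f: "M (Suc (20 + m)) = rad (Suc m)" "M (22 + 2 * S + m) = prev S r m"
      using less.prems(2,8) m radsD[of S rad M "Suc m"] nextsD[of S S M m] by (auto simp: tables_def)
    have bd: "rad (Suc m) \<le> v" "prev S r m \<le> v" "n \<le> v"
      using boundedD[OF less.prems(1), of "Suc (20 + m)"]
        boundedD[OF less.prems(1), of "22 + 2 * S + m"] boundedD[OF less.prems(1), of 10]
        f less.prems(5) by auto
    have o: "M 14 = p + 2 * length xs" "M 3 = length xs" "23 + 3 * S \<le> p"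
      using less.prems(3) by (auto simp: outputs_def)
    have hit: "{k \<in> bucket S r x. k < n \<and> rad (Suc k) = q} =
      (if m < n \<and> rad (Suc m) = q then insert m else id) {k \<in> B. k < n \<and> rad (Suc k) = q}"
      unfolding m(5) by auto
    note prems = less.prems[folded m_def, unfolded hit card]
    show ?thesis
    proof (cases "m < n \<and> rad (Suc m) = q")
      case True
      then show ?thesis
        unfolding card
        apply -
        apply (rule reaches_block[where k = 14 and T = "14 * card B + 1"])
        using prems(1-12) c S s v f bd o m(1-4) apply (simp add: benelux_program_nth)
          apply (rule reaches_mono, rule less.IH[of m _ "xs @ [(m, n)]", folded B_def])
        using prems c S s v f bd o m(1-4) by auto
    next
      case False
      \<comment> \<open>The common tail of both miss paths, which moves on to the successor.\<close>
      have go: "reach (14 * card B + 1 + 3) (74, M') (\<lambda>(pc, M). pc = 77 \<and> tables S M \<and>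
          M 15 = b \<and> M 10 = n \<and> (\<exists>zs. outputs S ys p zs M \<and> distinct zs \<and> set zs = A))"
        if "bounded v M'" "tables S M'" "outputs S ys p xs M'" "M' 15 = b" "M' 10 = n"
          "M' 17 = q" "M' 16 = m" "M' (22 + 2 * S + m) = prev S r m" for M'
      proof -
        have c': "M' 7 = 22 + 2 * S" using that by (auto simp: tables_def consts_ok_def)
        show ?thesis
          apply (rule reaches_block[where k = 3 and T = "14 * card B + 1"])
          using that c' prems(8,9,12) S s v bd m(1-4) apply (simp add: benelux_program_nth)
            apply (rule reaches_mono, rule less.IH[of m _ xs, folded B_def])
          using that c' prems(8-13) S s v bd m(1-4) False by auto
      qed
      show ?thesis
      proof (cases "rad (Suc m) = q")
        case True
        with False have "\<not> m < n" by simp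
        with True show ?thesis
          unfolding card
          apply -
          apply (rule reaches_block[where k = 7 and T = "14 * card B + 1 + 3"])
          using prems(1-12) c S s v f bd o m(1-4) apply (simp add: benelux_program_nth)
            apply (rule reaches_mono, rule go)
          using prems c S s v f bd o m(1-4) by auto
      next
        case False
        then show ?thesis
          unfolding card
          apply -
          apply (rule reaches_block[where k = 6 and T = "14 * card B + 1 + 3"])
          using prems(1-12) c S s v f bd o m(1-4) apply (simp add: benelux_program_nth)
            apply (rule reaches_mono, rule go)
          using prems c S s v f bd o m(1-4) by auto
      qed
    qed
  qed
qed

text \<open>The unspent budget of a pass; a good \<open>n\<close> uses up exactly the size of the
  list it walks through.\<close>

definition remaining :: "nat \<Rightarrow> nat \<Rightarrow> (nat \<times> nat) set" where
  "remaining b n = {(m, n') \<in> visited S b. n \<le> n'}"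

lemma finite_remaining: "finite (remaining b n)"
  by (rule finite_subset[OF _ finite_visited[of S b]]) (auto simp: remaining_def)

lemma remaining_Suc:
  assumes "0 < n" "n < S"
  shows "card (remaining b n) =
    (if good S n then card (bucket S (rad (n + b)) S) else 0) + card (remaining b (Suc n))"
proof -
  have "remaining b n = (if good S n then (\<lambda>k. (k, n)) ` bucket S (rad (n + b)) S else {}) \<union>
    remaining b (Suc n)"
    using assms by (auto simp: remaining_def visited_def bucket_def image_iff Suc_le_eq order.order_iff_strict)
  moreover have "card ((\<lambda>k. (k, n)) ` B) = card B" for B :: "nat set"
    by (rule card_image) (simp add: inj_on_def)
  moreover have "(\<lambda>k. (k, n)) ` B \<inter> remaining b (Suc n) = {}" for B
    by (auto simp: remaining_def)
  ultimately show ?thesis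
    by (simp add: card_Un_disjoint finite_remaining)
qed

text \<open>The 15 instructions per \<open>n\<close> are 12 before the walk, 1 to leave it and 2 to
  advance; everything else is paid from \<open>remaining\<close>.\<close>

lemma reach_pass:
  assumes "n + d = S" "0 < n" "b \<le> 1" "bounded v M" "tables S M" "outputs S ys p xs M"
    "M 15 = b" "M 10 = n" "distinct xs" "set xs = {(m, n') \<in> hits S b. n' < n}"
    "p + 2 * (length xs + card (remaining b n)) \<le> s"
  shows "reach (14 * card (remaining b n) + 15 * d + 1) (49, M) (\<lambda>(pc, M). pc = 79 \<and>
    tables S M \<and> M 15 = b \<and> (\<exists>zs. outputs S ys p zs M \<and> distinct zs \<and> set zs = hits S b))"
  using assms
proof (induction d arbitrary: n M xs)
  case 0
  then have c: "M 4 = S" by (auto simp: tables_def consts_ok_def)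
  have "{(m, n') \<in> hits S b. n' < n} = hits S b"
    using 0 by (auto simp: hits_def visited_def)
  then show ?case
    apply -
    apply (rule reaches_block[where k = 1 and T = 0])
    using 0 c S s v apply (simp add: benelux_program_nth)
      apply (rule reaches_refl)
    using 0 by auto
next
  case (Suc d)
  let ?Q = "\<lambda>(pc, M). pc = 79 \<and> tables S M \<and> M 15 = b \<and>
    (\<exists>zs. outputs S ys p zs M \<and> distinct zs \<and> set zs = hits S b)"
  have c: "M 4 = S" "M 5 = 20" "M 6 = 21 + S" "M 8 = 1" "M 9 = 2 * S"
    using Suc.prems by (auto simp: tables_def consts_ok_def)
  have rads: "rads S rad M" and heads: "heads S (\<lambda>r. prev S r S) M"
    using Suc.prems by (auto simp: tables_def)
  have b: "b = 0 \<or> b = 1" using Suc.prems by auto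
  define r where "r = rad (n + b)"
  define q where "q = rad (Suc n - b)"
  have f: "M (20 + n + b) = r" "M (Suc (20 + n) - b) = q"
    using radsD[OF rads, of n] radsD[OF rads, of "Suc n"] Suc.prems(1,2) b
    by (auto simp: r_def q_def)
  have a: "20 + n + b < s" "20 + n + b \<le> v" "Suc (20 + n) - b < s" "Suc (20 + n) - b \<le> v"
    using b s v Suc.prems(1) by auto
  \<comment> \<open>For b = 1 the two radicals swap roles, so the test against 2S decides
    \<open>good S n\<close> in both passes.\<close>
  have rq: "r * q = rad n * rad (Suc n)" using b by (auto simp: r_def q_def)
  have le: "r \<le> S" "q \<le> S" using rad_le[of n] rad_le[of "Suc n"] Suc.prems(1,2) b
    by (auto simp: r_def q_def)
  then have le': "r * q \<le> v" using mult_le_mono[of r S q S] v(2) by linarith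
  have h: "M (21 + S + r) = prev S r S" "prev S r S \<le> v"
    using headsD[OF heads le(1)] boundedD[OF Suc.prems(4), of "21 + S + r"] by auto
  have card: "card (remaining b n) =
      (if good S n then card (bucket S r S) else 0) + card (remaining b (Suc n))"
    unfolding r_def using Suc.prems by (intro remaining_Suc) auto
  have go: "reach (14 * card (remaining b (Suc n)) + 15 * d + 3) (77, M') ?Q"
    if "bounded v M'" "tables S M'" "outputs S ys p xs' M'" "M' 15 = b" "M' 10 = n" "distinct xs'"
      "set xs' = {(m, n') \<in> hits S b. n' < Suc n}"
      "p + 2 * (length xs' + card (remaining b (Suc n))) \<le> s" for M' xs'
  proof -
    have c': "M' 8 = 1" using that by (auto simp: tables_def consts_ok_def)
    show ?thesis
      apply (rule reaches_block[where k = 2 and T = "14 * card (remaining b (Suc n)) + 15 * d + 1"])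
      using that c' S s v Suc.prems(1) apply (simp add: benelux_program_nth)
        apply (rule reaches_mono, rule Suc.IH[of "Suc n" _ xs'])
      using that c' S s v Suc.prems(1-3) by simp_all
  qed
  have hits: "{(m, n') \<in> hits S b. n' < Suc n} = {(m, n') \<in> hits S b. n' < n} \<union>
      (if good S n then (\<lambda>k. (k, n)) ` {k \<in> bucket S r S. k < n \<and> rad (Suc k) = q} else {})"
    using Suc.prems(1,2) by (auto simp: hits_def visited_def bucket_def r_def q_def less_Suc_eq)
  show ?case
  proof (cases "good S n")
    case False
    then have "2 * S < r * q" by (simp add: good_def rq)
    then show ?thesis
      apply -
      apply (rule reaches_block[where k = 10 and
            T = "14 * card (remaining b (Suc n)) + 15 * d + 3"])
      using Suc.prems c S s v f a le le' apply (simp add: benelux_program_nth)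
        apply (rule reaches_mono, rule go[of _ xs])
      using Suc.prems c S s v le False by (simp_all add: hits card)
  next
    case True
    let ?A = "{(m, n') \<in> hits S b. n' < Suc n}"
    have A: "?A = set xs \<union> (\<lambda>k. (k, n)) ` {k \<in> bucket S r S. k < n \<and> rad (Suc k) = q}"
      unfolding hits Suc.prems using True by simp
    \<comment> \<open>Output length grows by at most the budget just spent, which restores the space
      invariant for the next \<open>n\<close>.\<close>
    have len: "length zs \<le> length xs + card (bucket S r S)" if "distinct zs" "set zs = ?A" for zs
    proof -
      have "length zs = card ?A" using that distinct_card by metis
      also have "\<dots> \<le> card (set xs) +
          card ((\<lambda>k. (k, n)) ` {k \<in> bucket S r S. k < n \<and> rad (Suc k) = q})"
        unfolding A by (rule card_Un_le)
      also have "\<dots> \<le> length xs + card (bucket S r S)"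
        by (intro add_mono card_length order.trans[OF card_image_le] card_mono) auto
      finally show ?thesis .
    qed
    have cont: "reach (14 * card (bucket S r S) + 1 +
        (14 * card (remaining b (Suc n)) + 15 * d + 3)) (61, M') ?Q"
      if M': "bounded v M'" "tables S M'" "outputs S ys p xs M'" "M' 15 = b" "M' 10 = n"
        "M' 17 = q" "M' 16 = prev S r S" for M'
    proof (rule reaches_trans[OF reach_walk[OF M' order.refl _ \<open>distinct xs\<close> _ _ A]])
      show "n < S" using Suc.prems(1) by simp
      show "\<forall>k < S. (k, n) \<notin> set xs" unfolding Suc.prems(10) by simp
      show "p + 2 * (length xs + card (bucket S r S)) \<le> s"
        using Suc.prems(11) card True by simp
      fix pc :: nat and M''
      assume post: "case (pc, M'') of (pc, M) \<Rightarrow> pc = 77 \<and> tables S M \<and> M 15 = b \<and> M 10 = n \<and>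
        (\<exists>zs. outputs S ys p zs M \<and> distinct zs \<and> set zs = ?A)" and "bounded v M''"
      then obtain zs where zs: "pc = 77" "tables S M''" "M'' 15 = b" "M'' 10 = n"
        "outputs S ys p zs M''" "distinct zs" "set zs = ?A" by auto
      show "reach (14 * card (remaining b (Suc n)) + 15 * d + 3) (pc, M'') ?Q"
        unfolding \<open>pc = 77\<close>
        by (rule go[of M'' zs]) (use zs \<open>bounded v M''\<close> len[of zs] Suc.prems(11) card True in simp_all)
    qed simp
    from True have "\<not> 2 * S < r * q" by (simp add: good_def rq)
    then show ?thesis
      apply -
      apply (rule reaches_block[where k = 12 and T = "14 * card (bucket S r S) + 1 +
            (14 * card (remaining b (Suc n)) + 15 * d + 3)"])
      using Suc.prems(1-8) c S s v f a le le' h apply (simp add: benelux_program_nth)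
        apply (rule reaches_mono, rule cont)
      using Suc.prems(1-8) c S s v le h True by (simp_all add: card)
  qed
qed

lemma reach_pass_start:
  assumes "b \<le> 1" "bounded v M" "tables S M" "M 15 = b" "M 14 = p" "23 + 3 * S \<le> M 0"
    "M 0 + 2 * M 1 \<le> p" "pairs_at M (M 0) (M 1) = ys" "p + 2 * card (visited S b) \<le> s"
  shows "reach (14 * card (visited S b) + 15 * S + 4) (46, M) (\<lambda>(pc, M). pc = 79 \<and>
    tables S M \<and> M 15 = b \<and> (\<exists>zs. outputs S ys p zs M \<and> distinct zs \<and> set zs = hits S b))"
proof -
  have c: "M 8 = 1" using assms by (auto simp: tables_def consts_ok_def)
  have r: "remaining b (Suc 0) = visited S b" by (auto simp: remaining_def visited_def)
  have e: "{(m, n') \<in> hits S b. n' < Suc 0} = {}" by (auto simp: hits_def)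
  have o: "outputs S ys p [] (M(2 := p, 3 := 0, 10 := Suc 0))"
    using assms by (auto simp: outputs_def pairs_at_def)
  show ?thesis
    apply (rule reaches_block[where k = 3 and T = "14 * card (visited S b) + 15 * (S - 1) + 1"])
    using assms c S s v apply (simp add: benelux_program_nth)
      apply (rule reaches_mono, rule reach_pass[where n = "Suc 0" and d = "S - 1" and b = b
          and xs = "[]" and ys = ys and p = p])
    using assms c S s v o e r by simp_all
qed

lemma card_hits_le: "card (hits S b) \<le> card (visited S b)"
  by (rule card_mono[OF finite_visited]) (auto simp: hits_def)

lemma reach_output:
  assumes s_eq: "s = 23 + 3 * S + 2 * (card (visited S 0) + card (visited S 1))"
  shows "reach (7 * (\<Sum>i = 1..S. S div i) + 58 * S +
      14 * (card (visited S 0) + card (visited S 1)) + 50) (initial S)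
    (\<lambda>(pc, M). length benelux_program \<le> pc \<and>
      (\<exists>ys zs. pairs_at M (M 0) (M 1) = ys \<and> distinct ys \<and> set ys = hits S 0 \<and>
        pairs_at M (M 2) (M 3) = zs \<and> distinct zs \<and> set zs = hits S 1))"
  (is "reach ?T _ ?Q")
proof -
  define Q where "Q = ?Q"
  have T: "(\<Sum>l = 2..S. 7 * (S div l) + 9) \<le> 7 * (\<Sum>i = 1..S. S div i) + 9 * S"
  proof -
    have "(\<Sum>l = 2..S. 7 * (S div l) + 9) \<le> (\<Sum>l = 1..S. 7 * (S div l) + 9)"
      by (rule sum_mono2) auto
    also have "\<dots> = 7 * (\<Sum>i = 1..S. S div i) + 9 * S"
      by (simp add: sum.distrib sum_distrib_left)
    finally show ?thesis .
  qed
  \<comment> \<open>The phases are composed backwards: each fact leads from one label all the way to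
    the final state.\<close>
  have pass1: "reach (14 * card (visited S 1) + 15 * S + 5) (46, M) Q"
    if "bounded v M" "tables S M" "M 15 = 1" "M 14 = p" "23 + 3 * S \<le> M 0"
      "M 0 + 2 * M 1 \<le> p" "pairs_at M (M 0) (M 1) = ys" "p + 2 * card (visited S 1) \<le> s"
      "distinct ys" "set ys = hits S 0" for M p ys
  proof (rule reaches_trans[OF reach_pass_start[of 1 M p ys]])
    fix pc :: nat and M'
    assume post: "case (pc, M') of (pc, M) \<Rightarrow> pc = 79 \<and> tables S M \<and> M 15 = 1 \<and>
      (\<exists>zs. outputs S ys p zs M \<and> distinct zs \<and> set zs = hits S 1)" and "bounded v M'"
    then have c: "pc = 79" "M' 8 = 1" "M' 15 = 1" by (auto simp: tables_def consts_ok_def)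
    from post have fin: "\<exists>ys zs. pairs_at M' (M' 0) (M' 1) = ys \<and> distinct ys \<and> set ys = hits S 0 \<and>
        pairs_at M' (M' 2) (M' 3) = zs \<and> distinct zs \<and> set zs = hits S 1"
      using that(9,10) by (auto simp: outputs_def)
    show "reach 1 (pc, M') Q"
      unfolding \<open>pc = 79\<close>
      apply (rule reaches_block[where k = 1 and T = 0])
      using \<open>bounded v M'\<close> c S s v apply (simp add: benelux_program_nth)
        apply (rule reaches_refl)
      using \<open>bounded v M'\<close> fin by (auto simp: Q_def)
  qed (use that in auto)
  have pass0: "reach (14 * (card (visited S 0) + card (visited S 1)) + 30 * S + 14) (46, M) Q"
    if "bounded v M" "tables S M" "no_output S M" for M
  proof (rule reaches_trans[OF reach_pass_start[of 0 M "23 + 3 * S" "[]"]])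
    fix pc :: nat and M'
    assume post: "case (pc, M') of (pc, M) \<Rightarrow> pc = 79 \<and> tables S M \<and> M 15 = 0 \<and>
      (\<exists>zs. outputs S [] (23 + 3 * S) zs M \<and> distinct zs \<and> set zs = hits S 0)" and "bounded v M'"
    then obtain zs where zs: "pc = 79" "tables S M'" "M' 15 = 0" "outputs S [] (23 + 3 * S) zs M'"
      "distinct zs" "set zs = hits S 0" by auto
    have c: "M' 8 = 1" using zs by (auto simp: tables_def consts_ok_def)
    have o: "M' 2 = 23 + 3 * S" "M' 3 = length zs" "M' 14 = 23 + 3 * S + 2 * length zs"
      "pairs_at M' (23 + 3 * S) (length zs) = zs" using zs by (auto simp: outputs_def)
    have len: "length zs \<le> card (visited S 0)"
      using zs card_hits_le[of 0] distinct_card by metis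
    then have cap: "23 + 3 * S + 2 * length zs + 2 * card (visited S 1) \<le> s"
      using s_eq by simp
    show "reach (14 * card (visited S 1) + 15 * S + 10) (pc, M') Q"
      unfolding \<open>pc = 79\<close>
      apply (rule reaches_block[where k = 5 and T = "14 * card (visited S 1) + 15 * S + 5"])
      using zs o c s v cap \<open>bounded v M'\<close> apply (simp add: benelux_program_nth)
        apply (rule reaches_mono, rule pass1[where p = "23 + 3 * S + 2 * length zs" and ys = zs])
      using zs o c s v cap \<open>bounded v M'\<close> by simp_all
  qed (use that s_eq in \<open>auto simp: no_output_def pairs_at_def\<close>)
  have build: "reach (14 * (card (visited S 0) + card (visited S 1)) + 44 * S + 16) (31, M) Q"
    if M: "bounded v M" "no_output S M" "heads S (\<lambda>_. 0) M" "rads S rad M" for M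
  proof -
    have c: "M 8 = 1" using M by (auto simp: no_output_def consts_ok_def)
    show ?thesis
      apply (rule reaches_block[where k = 1 and T = "14 * (card (visited S 0) + card (visited S 1)) + 44 * S + 15"])
      using M c s v S apply (simp add: benelux_program_nth)
        apply (rule reaches_trans)
          apply (rule reach_build[where n = "Suc 0" and d = "S - 1"])
      using M c s v S apply simp_all
        apply (simp add: heads_def prev_1 fun_upd_apply)
       apply (simp add: nexts_def)
      apply (rule pass0)
      by simp_all
  qed
  have sieve: "reach ((\<Sum>l = 2..S. 7 * (S div l) + 9) +
      14 * (card (visited S 0) + card (visited S 1)) + 44 * S + 18) (16, M) Q"
    if M: "bounded v M" "no_output S M" "heads S (\<lambda>_. 0) M" "rads S (sieved 2) M" for M
  proof -
    have c: "M 8 = 1" using M by (auto simp: no_output_def consts_ok_def)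
    show ?thesis
      apply (rule reaches_block[where k = 1 and T = "(\<Sum>l = 2..S. 7 * (S div l) + 9) +
          14 * (card (visited S 0) + card (visited S 1)) + 44 * S + 17"])
      using M c s v S apply (simp add: benelux_program_nth)
        apply (rule reaches_trans)
          apply (rule reach_sieve[where i = 2 and d = "S - 1"])
      using M c s v S apply simp_all
      apply (rule build)
      by simp_all
  qed
  have init: "reach (?T - 11) (pc, M) Q"
    if M: "pc = 11" "bounded v M" "no_output S M" "heads S (\<lambda>_. 0) M" "M 10 = 0" for pc M
    unfolding \<open>pc = 11\<close>
  proof (rule reaches_trans[OF reach_init[where n = 0 and d = "Suc S"]])
    fix pc :: nat and M'
    assume "case (pc, M') of (pc, M) \<Rightarrow> pc = 16 \<and> no_output S M \<and> heads S (\<lambda>_. 0) M \<and>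
      rads S (sieved 2) M" and "bounded v M'"
    then show "reach ((\<Sum>l = 2..S. 7 * (S div l) + 9) +
      14 * (card (visited S 0) + card (visited S 1)) + 44 * S + 18) (pc, M') Q"
      using sieve by auto
  qed (use M T in auto)
  have z: "bounded v (\<lambda>_. 0)" by (simp add: bounded_def)
  show ?thesis
    unfolding initial_def Q_def[symmetric]
    apply (rule reaches_block[where k = 11 and T = "?T - 11"])
    using S s v z apply (simp add: benelux_program_nth)
      apply (rule reaches_mono, rule init)
    using S s v z by (simp_all add: no_output_def consts_ok_def heads_def)
qed

end

section \<open>Correctness and asymptotic bounds together\<close>

theorem mainTheorem2:
  "\<exists>P :: program.
     (\<forall>S \<ge> 2. computes_benelux_pairs P S) \<and>
     (\<lambda>S. real (running_time P S)) \<in> O(\<lambda>S. real S * ln (real S)) \<and>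
     (\<lambda>S. real (space_used P S)) \<in> O(\<lambda>S. real S) \<and>
     (\<exists>d :: nat. (\<lambda>S. real (max_value P S)) \<in> O(\<lambda>S. real S ^ d))"
proof -
  let ?P = benelux_program
  let ?c = "\<lambda>S. card (visited S 0) + card (visited S 1)"
  obtain K where K: "0 < K" "\<And>S b. 0 < S \<Longrightarrow> real (card (visited S b)) \<le> K * real S"
    using card_visited_bound by blast
  define s where "s S = 23 + 3 * S + 2 * ?c S" for S
  define v where "v S = s S + S * S + 2 * S" for S
  define T where "T S = 7 * (\<Sum>i = 1..S. S div i) + 58 * S + 14 * ?c S + 50" for S
  have run: "reaches ?P (s S) (v S) (T S) (initial S) (\<lambda>(pc, M). length ?P \<le> pc \<and>
      (\<exists>ys zs. pairs_at M (M 0) (M 1) = ys \<and> distinct ys \<and> set ys = hits S 0 \<and>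
        pairs_at M (M 2) (M 3) = zs \<and> distinct zs \<and> set zs = hits S 1))" if "2 \<le> S" for S
    unfolding T_def
    by (rule resources.reach_output) (use that in \<open>auto simp: resources_def s_def v_def\<close>)
  note final = reaches_halted[OF run]
  have c: "real (?c S) \<le> 2 * K * real S" if "2 \<le> S" for S
    using K(2)[of S 0] K(2)[of S 1] that by (simp add: mult.assoc)
  have s_le: "real (s S) \<le> (15 + 4 * K) * real S" if "2 \<le> S" for S
    using c[OF that] that by (simp add: s_def algebra_simps)
  have ev: "\<forall>\<^sub>F S in at_top. 2 \<le> (S::nat)" by (rule eventually_ge_at_top)
  have "computes_benelux_pairs ?P S" if "2 \<le> S" for S
    using final(1,2)[OF that] hits_0[of S] hits_1[of S]
    by (auto simp: computes_benelux_pairs_def output1_def output2_def Let_def)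
  then have "\<forall>S \<ge> 2. computes_benelux_pairs ?P S" by simp
  moreover have "(\<lambda>S. real (running_time ?P S)) \<in> O(\<lambda>S. real S * ln (real S))"
  proof (rule bigoI[of _ "7 + (90 + 28 * K) / ln 2"], rule eventually_mono[OF ev])
    fix S :: nat
    assume S: "2 \<le> S"
    have ln: "0 < ln (2::real)" "ln 2 \<le> ln (real S)" "0 < ln (real S)" using S by auto
    have "real (running_time ?P S) \<le> real (T S)" using final(3)[OF S] by simp
    also have "\<dots> \<le> 7 * (real S * (1 + ln (real S))) + 58 * real S + 14 * (2 * K * real S) + 25 * real S"
      unfolding T_def using sum_div_le[of S] c[OF S] S by simp
    also have "\<dots> = 7 * (real S * ln (real S)) + (90 + 28 * K) * real S"
      by (simp add: algebra_simps)
    \<comment> \<open>Since S \<ge> 2, the ratio ln S / ln 2 is at least 1 and absorbs the linear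
      term.\<close>
    also have "(90 + 28 * K) * real S \<le> (90 + 28 * K) * (real S * (ln (real S) / ln 2))"
      using ln S K(1) by (intro mult_left_mono) (auto simp: field_simps)
    finally show "norm (real (running_time ?P S)) \<le>
        (7 + (90 + 28 * K) / ln 2) * norm (real S * ln (real S))"
      using ln by (simp add: algebra_simps abs_mult add_divide_distrib)
  qed
  moreover have "(\<lambda>S. real (space_used ?P S)) \<in> O(\<lambda>S. real S)"
  proof (rule bigoI[of _ "15 + 4 * K"], rule eventually_mono[OF ev])
    fix S :: nat
    assume S: "2 \<le> S"
    show "norm (real (space_used ?P S)) \<le> (15 + 4 * K) * norm (real S)"
      using final(4)[OF S] s_le[OF S] by simp
  qed
  moreover have "(\<lambda>S. real (max_value ?P S)) \<in> O(\<lambda>S. real S ^ 2)"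
  proof (rule bigoI[of _ "18 + 4 * K"], rule eventually_mono[OF ev])
    fix S :: nat
    assume S: "2 \<le> S"
    have "real (max_value ?P S) \<le> real (v S)" using final(5)[OF S] by simp
    also have "\<dots> \<le> (15 + 4 * K) * real S + real S ^ 2 + 2 * real S"
      using s_le[OF S] by (simp add: v_def power2_eq_square)
    also have "\<dots> = (17 + 4 * K) * real S + real S ^ 2" by (simp add: algebra_simps)
    also have "\<dots> \<le> (17 + 4 * K) * real S ^ 2 + real S ^ 2"
      using S K(1) self_le_power[of "real S" 2] by (intro add_mono mult_left_mono) auto
    finally show "norm (real (max_value ?P S)) \<le> (18 + 4 * K) * norm (real S ^ 2)"
      by (simp add: algebra_simps)
  qed
  ultimately show ?thesis
    by (intro exI[of _ ?P] exI[of _ 2] conjI)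
qed

end
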